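(* Let $G$ be a finite nilpotent group which is not a $p$-group (for any prime $p$). Then the difference graph $\mathcal{D}(G)$ is Eulerian if and only if $|G|$ is odd.
   Context: Difference graph: for a finite group $G$, the power graph $\mathcal{P}(G)$ is the simple undirected graph with vertex set $G$ in which distinct $a,b$ are adjacent iff $a\in\langle b\rangle$ or $b\in\langle a\rangle$. The enhanced power graph $\mathcal{P}_E(G)$ is the simple undirected graph with vertex set $G$ in which distinct $a,b$ are adjacent iff $a,b\in\langle c\rangle$ for some $c\in G$. The difference graph $\mathcal{D}(G)$ is obtained from the graph $\mathcal{P}_E(G)-\mathcal{P}(G)$ (vertex set $G$; two vertices are adjacent iff they are adjacent in $\mathcal{P}_E(G)$ but not in $\mathcal{P}(G)$) by removing all isolated vertices. A graph is Eulerian if it is connected and has a closed trail (closed walk with no repeated edge) containing all the edges of the graph. *)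

theory Defs
  imports "HOL-Algebra.Algebra" "Graph_Theory.Graph_Theory"
begin

text \<open>
  A simple undirected graph is represented, as in \<^locale>\<open>pair_graph\<close>, by a symmetric and
  irreflexive set of vertex pairs: the edge \<open>{a, b}\<close> is the pair of arcs \<open>(a, b)\<close>, \<open>(b, a)\<close>.
\<close>

subsection \<open>Power graph, enhanced power graph, difference graph\<close>

definition power_graph :: "('a, 'b) monoid_scheme \<Rightarrow> 'a pair_pre_digraph" where
  "power_graph G = \<lparr> pverts = carrier G,
     parcs = {(a, b). a \<in> carrier G \<and> b \<in> carrier G \<and> a \<noteq> b \<and>
       (a \<in> generate G {b} \<or> b \<in> generate G {a})} \<rparr>"

definition enhanced_power_graph :: "('a, 'b) monoid_scheme \<Rightarrow> 'a pair_pre_digraph" where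
  "enhanced_power_graph G = \<lparr> pverts = carrier G,
     parcs = {(a, b). a \<in> carrier G \<and> b \<in> carrier G \<and> a \<noteq> b \<and>
       (\<exists>c \<in> carrier G. a \<in> generate G {c} \<and> b \<in> generate G {c})} \<rparr>"

definition edge_difference ::
    "'a pair_pre_digraph \<Rightarrow> 'a pair_pre_digraph \<Rightarrow> 'a pair_pre_digraph" where
  "edge_difference H K = \<lparr> pverts = pverts H, parcs = parcs H - parcs K \<rparr>"

definition remove_isolated :: "'a pair_pre_digraph \<Rightarrow> 'a pair_pre_digraph" where
  "remove_isolated H =
     \<lparr> pverts = {v \<in> pverts H. \<exists>w. (v, w) \<in> parcs H \<or> (w, v) \<in> parcs H}, parcs = parcs H \<rparr>"

definition difference_graph :: "('a, 'b) monoid_scheme \<Rightarrow> 'a pair_pre_digraph" where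
  "difference_graph G =
     remove_isolated (edge_difference (enhanced_power_graph G) (power_graph G))"

lemma pair_graph_difference_graph:
  assumes "finite (carrier G)"
  shows "pair_graph (difference_graph G)"
proof
  show "finite (parcs (difference_graph G))"
    by (rule finite_subset[of _ "carrier G \<times> carrier G"])
      (use assms in \<open>auto simp: difference_graph_def remove_isolated_def edge_difference_def
         enhanced_power_graph_def\<close>)
qed (use assms in \<open>auto simp: difference_graph_def remove_isolated_def edge_difference_def
       enhanced_power_graph_def power_graph_def symmetric_def sym_def\<close>)

subsection \<open>Eulerian graphs\<close>

text \<open>
  Each undirected edge is present as two opposite arcs, so \<^const>\<open>pre_digraph.trail\<close> and
  \<^const>\<open>pre_digraph.euler_trail\<close> would permit (respectively demand) traversing every edge
  once in each direction. Hence repetition and coverage are measured on the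
  underlying unordered pairs.
\<close>

definition edge_of :: "'a \<times> 'a \<Rightarrow> 'a set" where
  "edge_of e = {fst e, snd e}"

definition closed_edge_trail :: "'a pair_pre_digraph \<Rightarrow> 'a \<Rightarrow> ('a \<times> 'a) awalk \<Rightarrow> bool" where
  "closed_edge_trail H u p \<longleftrightarrow>
     pre_digraph.awalk (with_proj H) u p u \<and> distinct (map edge_of p)"

definition eulerian :: "'a pair_pre_digraph \<Rightarrow> bool" where
  "eulerian H \<longleftrightarrow> Digraph_Component.connected (with_proj H) \<and>
     (\<exists>u p. closed_edge_trail H u p \<and> edge_of ` set p = edge_of ` parcs H)"

subsection \<open>Nilpotent groups and p-groups\<close>

primrec lower_central_series :: "('a, 'b) monoid_scheme \<Rightarrow> nat \<Rightarrow> 'a set" where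
  "lower_central_series G 0 = carrier G"
| "lower_central_series G (Suc n) = generate G
     (\<Union>x \<in> lower_central_series G n. \<Union>y \<in> carrier G.
        {x \<otimes>\<^bsub>G\<^esub> y \<otimes>\<^bsub>G\<^esub> inv\<^bsub>G\<^esub> x \<otimes>\<^bsub>G\<^esub> inv\<^bsub>G\<^esub> y})"

definition nilpotent_group :: "('a, 'b) monoid_scheme \<Rightarrow> bool" where
  "nilpotent_group G \<longleftrightarrow> group G \<and> (\<exists>n. lower_central_series G n = {\<one>\<^bsub>G\<^esub>})"

text \<open>For finite groups only; the trivial group is a \<open>p\<close>-group for every prime \<open>p\<close>.\<close>

definition p_group :: "nat \<Rightarrow> ('a, 'b) monoid_scheme \<Rightarrow> bool" where
  "p_group p G \<longleftrightarrow> group G \<and> (\<exists>k. order G = p ^ k)"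

end

theory Submission
  imports Defs "HOL-Number_Theory.Prime_Powers" "HOL-Library.Disjoint_Sets" "HOL-Library.Z2"
begin

text \<open>
  In a nilpotent group elements of coprime order commute, so two non-identity elements of coprime
  order are adjacent in the difference graph. Since at least two primes divide the order, the elements
  of prime power order are connected to each other; any other vertex \<open>v\<close> with a neighbour
  \<open>w\<close> is adjacent to a power of \<open>w\<close> of prime power order lying outside
  \<open>\<langle>v\<rangle>\<close>.

  Neighbourhoods are closed under inversion. If the order is odd, inversion has no fixed points among the
  vertices and the edges split into four-cycles \<open>a, b, a\<^sup>-\<^sup>1, b\<^sup>-\<^sup>1\<close>, which
  yields an Euler circuit. If the order is even, the inverse-fixed neighbours of an element of odd
  prime power order are all the involutions of the group, as they commute with
  it; their number is odd, hence so is the degree of that element.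
\<close>

section \<open>Parity under an involution and coprime factorisations\<close>

text \<open>The points moved by \<open>h\<close> fall into pairs \<open>x\<close>,
  \<open>h x\<close>, so only the fixed points affect the parity.\<close>

lemma even_card_involution_iff:
  assumes fin: "finite A"
    and h: "\<And>x. x \<in> A \<Longrightarrow> h x \<in> A" "\<And>x. x \<in> A \<Longrightarrow> h (h x) = x"
  shows "even (card A) \<longleftrightarrow> even (card {x \<in> A. h x = x})"
proof -
  let ?Y = "{x \<in> A. h x \<noteq> x}"
  \<comment> \<open>Counting in the field with two elements turns the pairing into a cancellation:
    each pair contributes 1 + 1 = 0.\<close>
  have "(\<Sum>x\<in>?Y. 1 :: bit) = 0"
    by (rule sum_involution_eq_0[where h = h]) (use h in auto)
  moreover have "of_nat n = (0 :: bit) \<longleftrightarrow> even n" for n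
    by (induction n) auto
  ultimately have "even (card ?Y)"
    by simp
  moreover have "card A = card ?Y + card {x \<in> A. h x = x}"
    using fin by (subst card_Un_disjoint[symmetric]) (auto intro: arg_cong[where f = card])
  ultimately show ?thesis
    by simp
qed

text \<open>Split off the full power of a prime divisor of \<open>n\<close>; the cofactor is not 1,
  since otherwise \<open>n\<close> would be a prime power.\<close>

lemma coprime_split_if_not_primepow:
  fixes n :: nat
  assumes "n > 1" "\<not> primepow n"
  obtains a b where "n = a * b" "coprime a b" "a > 1" "b > 1"
proof -
  obtain p where p: "Factorial_Ring.prime p" "p dvd n"
    using assms(1) prime_factor_nat[of n] by auto
  then obtain m where m: "n = p ^ multiplicity p n * m" "\<not> p dvd m"
    using multiplicity_decompose'[of n p] assms(1) not_prime_unit[of p]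
    by (metis less_nat_zero_code)
  have k: "multiplicity p n > 0"
    using p assms(1) by (simp add: prime_multiplicity_gt_zero_iff)
  show ?thesis
  proof (rule that[OF m(1)])
    show "coprime (p ^ multiplicity p n) m"
      using p(1) m(2) by (simp add: prime_imp_coprime)
    show "p ^ multiplicity p n > 1"
      using prime_gt_1_nat[OF p(1)] k by (intro one_less_power) auto
    have "m \<noteq> 0"
      using m(2) by (metis dvd_0_right)
    moreover have "m \<noteq> 1"
      using m(1) assms(2) p(1) k unfolding primepow_def by (metis mult.right_neutral)
    ultimately show "m > 1"
      by simp
  qed
qed

section \<open>Cyclic subgroups and elements of coprime order\<close>

context group
begin

lemma ord_dvd_if_mem_generate:
  assumes "y \<in> carrier G" "x \<in> generate G {y}"
  shows "ord x dvd ord y"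
proof -
  obtain k :: int where k: "x = y [^] k"
    using assms by (auto simp: generate_pow)
  have "x [^] int (ord y) = (y [^] int (ord y)) [^] k"
    using assms(1) by (simp only: k int_pow_pow mult.commute)
  also have "\<dots> = \<one>"
    using assms(1) by (simp add: int_pow_int)
  finally have "x [^] ord y = \<one>"
    by (simp add: int_pow_int)
  then show ?thesis
    using assms k by (simp add: pow_eq_id)
qed

lemma mem_generate_self: "x \<in> generate G {x}"
  by (simp add: generate.incl)

lemma generate_mono_mem:
  assumes "c \<in> carrier G" "x \<in> generate G {c}"
  shows "generate G {x} \<subseteq> generate G {c}"
  using assms by (intro generate_subgroup_incl generate_is_subgroup) auto

lemma generate_inv:
  assumes "x \<in> carrier G"
  shows "generate G {inv x} = generate G {x}"
proof -
  have "generate G {inv y} \<subseteq> generate G {y}" if "y \<in> carrier G" for y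
    using that by (intro generate_mono_mem generate.inv) auto
  from this[of x] this[of "inv x"] show ?thesis
    using assms by auto
qed

lemma inv_mem_generate_iff:
  assumes "c \<in> carrier G" "x \<in> carrier G"
  shows "inv x \<in> generate G {c} \<longleftrightarrow> x \<in> generate G {c}"
  using generate_m_inv_closed[of "{c}"] assms by (metis empty_subsetI insert_subset inv_inv)

lemma pow_mem_generate:
  assumes "x \<in> carrier G"
  shows "x [^] (n :: nat) \<in> generate G {x}"
  using assms int_pow_int[of G x n] by (auto simp: generate_pow intro!: exI[of _ "int n"])

text \<open>By Bezout, \<open>u * ord x + v * n = 1\<close>, hence \<open>x\<close> is the
  \<open>v\<close>-th power of \<open>x [^] n\<close>.\<close>

lemma mem_generate_pow_if_coprime:
  assumes "x \<in> carrier G" "coprime (ord x) n"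
  shows "x \<in> generate G {x [^] n}"
proof -
  have "coprime (int (ord x)) (int n)"
    using assms(2) by simp
  then obtain u v where uv: "u * int (ord x) + v * int n = 1"
    by (metis bezout_int coprime_imp_gcd_eq_1)
  have "x = x [^] (u * int (ord x) + v * int n)"
    using assms(1) by (simp add: uv)
  also have "\<dots> = x [^] (int (ord x) * u) \<otimes> x [^] (int n * v)"
    using assms(1) by (simp add: int_pow_mult mult.commute)
  also have "\<dots> = (x [^] n) [^] v"
    using assms(1) by (simp only: int_pow_pow[symmetric] int_pow_int)
      (simp add: int_pow_one)
  finally show ?thesis
    using assms(1) by (auto simp: generate_pow)
qed

text \<open>Every element is a product of powers of itself that have prime power order. Read
  contrapositively, an element outside \<open>H\<close> has a power of prime power order outside
  \<open>H\<close>.\<close>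

lemma mem_subgroup_if_primepow_parts_mem:
  assumes fin: "finite (carrier G)" and H: "subgroup H G" and "y \<in> carrier G"
    and "\<And>z. z \<in> generate G {y} \<Longrightarrow> primepow (ord z) \<Longrightarrow> z \<in> H"
  shows "y \<in> H"
  using assms(3,4)
proof (induction "ord y" arbitrary: y rule: less_induct)
  case less
  note y = less.prems(1)
  have "ord y \<ge> 1"
    using ord_ge_1[OF fin y] .
  then consider "ord y = 1" | "primepow (ord y)" | "ord y > 1" "\<not> primepow (ord y)"
    by linarith
  then show ?case
  proof cases
    case 1
    then show ?thesis
      using y ord_eq_1 subgroup.one_closed[OF H] by auto
  next
    case 2
    then show ?thesis
      using less.prems(2) mem_generate_self by blast
  next
    case 3
    then obtain a b where ab: "ord y = a * b" "coprime a b" "a > 1" "b > 1"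
      by (rule coprime_split_if_not_primepow)
    \<comment> \<open>Raising to a proper power \<open>d\<close> dividing the order divides the
      order by \<open>d\<close>, and the cyclic subgroup only shrinks, so the induction hypothesis
      applies.\<close>
    have pow: "y [^] d \<in> H" if d: "d dvd ord y" "d > 1" for d
    proof (rule less.hyps)
      have "ord (y [^] d) = ord y div d"
        using ord_pow[OF y, of d] d 3 by auto
      then show "ord (y [^] d) < ord y"
        using d 3 by simp
      show "z \<in> H" if "z \<in> generate G {y [^] d}" "primepow (ord z)" for z
        using that generate_mono_mem[OF y pow_mem_generate[OF y]] less.prems(2) by blast
    qed (use y in simp)
    have "coprime (int a) (int b)"
      using ab(2) by simp
    then obtain u v where uv: "u * int a + v * int b = 1"
      by (metis bezout_int coprime_imp_gcd_eq_1)
    have "y = y [^] (u * int a + v * int b)"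
      using y by (simp add: uv)
    also have "\<dots> = y [^] (int a * u) \<otimes> y [^] (int b * v)"
      using y by (simp add: int_pow_mult mult.commute)
    also have "\<dots> = (y [^] a) [^] u \<otimes> (y [^] b) [^] v"
      using y by (simp only: int_pow_pow[symmetric] int_pow_int)
    also have "\<dots> \<in> H"
      using ab by (intro subgroup.m_closed[OF H] subgroup_int_pow_closed[OF H] pow) auto
    finally show ?thesis .
  qed
qed

text \<open>A Sylow \<open>p\<close>-subgroup is nontrivial, and each of its non-identity elements
  has order a positive power of \<open>p\<close>.\<close>

lemma exists_primepow_ord:
  assumes fin: "finite (carrier G)" and p: "Factorial_Ring.prime p" "p dvd order G"
  obtains x k where "x \<in> carrier G" "k > 0" "ord x = p ^ k"
proof -
  have "order G \<noteq> 0"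
    using fin order_gt_0_iff_finite by simp
  obtain m where m: "order G = p ^ multiplicity p (order G) * m"
    using multiplicity_dvd[of p "order G"] by (rule dvdE)
  have k: "multiplicity p (order G) > 0"
    using p \<open>order G \<noteq> 0\<close> by (simp add: prime_multiplicity_gt_zero_iff)
  have "\<exists>H. subgroup H G \<and> card H = p ^ multiplicity p (order G)"
    by (rule sylow_thm[OF p(1) is_group m fin])
  then obtain H where H: "subgroup H G" "card H = p ^ multiplicity p (order G)"
    by (elim exE conjE)
  have "card H > 1"
    unfolding H(2) using k prime_gt_1_nat[OF p(1)] by (intro one_less_power) auto
  then have "\<not> H \<subseteq> {\<one>}"
    using card_mono[of "{\<one>}" H] by auto
  then obtain x where x: "x \<in> H" "x \<noteq> \<one>"
    by auto
  have xG: "x \<in> carrier G"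
    using subgroup.mem_carrier[OF H(1) x(1)] .
  \<comment> \<open>Lagrange inside \<open>H\<close>; powers taken in \<open>H\<close> and in
    \<open>G\<close> agree.\<close>
  have "x [^] card H = \<one>"
  proof -
    interpret H: group "G\<lparr>carrier := H\<rparr>"
      using H(1) by (rule subgroup_imp_group)
    have "x [^]\<^bsub>G\<lparr>carrier := H\<rparr>\<^esub> card H = \<one>"
      using H.pow_order_eq_1[of x] x(1) by (simp add: order_def)
    then show ?thesis
      unfolding nat_pow_consistent[of x "card H" H, symmetric] .
  qed
  then have "ord x dvd p ^ multiplicity p (order G)"
    using pow_eq_id[OF xG] H(2) by metis
  then obtain k where ord: "ord x = p ^ k"
    using divides_primepow_nat[OF p(1)] by metis
  have "k > 0"
    using ord_eq_1[OF xG] x(2) ord by (cases k) auto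
  with xG ord show ?thesis
    by (rule_tac that)
qed

section \<open>Elements of coprime order commute in a nilpotent group\<close>

lemma inv_mult_cancel:
  assumes "x \<in> carrier G" "y \<in> carrier G"
  shows "inv x \<otimes> (x \<otimes> y) = y" "x \<otimes> (inv x \<otimes> y) = y"
  using assms by (simp_all flip: m_assoc)

text \<open>Moving \<open>x\<close> past one \<open>y\<close> costs a factor \<open>c\<close>. As
  \<open>c\<close> commutes with \<open>y\<close>, moving it past \<open>y [^] k\<close> costs
  \<open>c [^] k\<close>; for \<open>k = n\<close> there is nothing to pass.\<close>

lemma central_commutator_pow_eq_one:
  assumes "x \<in> carrier G" "y \<in> carrier G" "c \<in> carrier G"
    and comm: "x \<otimes> y = c \<otimes> y \<otimes> x" and cy: "c \<otimes> y = y \<otimes> c"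
    and y: "y [^] (n :: nat) = \<one>"
  shows "c [^] n = \<one>"
proof -
  have "x \<otimes> y [^] k = c [^] k \<otimes> y [^] k \<otimes> x" for k :: nat
  proof (induction k)
    case (Suc k)
    have cyk: "y [^] k \<otimes> c = c \<otimes> y [^] k"
      using group_commutes_pow[OF cy[symmetric] assms(2,3)] .
    have "x \<otimes> y [^] Suc k = (x \<otimes> y [^] k) \<otimes> y"
      using assms(1-3) by (simp add: m_assoc)
    also have "\<dots> = c [^] k \<otimes> y [^] k \<otimes> (x \<otimes> y)"
      using assms(1-3) by (simp add: Suc m_assoc)
    also have "\<dots> = c [^] k \<otimes> (y [^] k \<otimes> c) \<otimes> y \<otimes> x"
      using assms(1-3) by (simp add: comm m_assoc)
    also have "\<dots> = c [^] Suc k \<otimes> y [^] Suc k \<otimes> x"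
      using assms(1-3) by (simp add: cyk m_assoc)
    finally show ?case .
  qed (use assms in simp)
  from this[of n] have "x = c [^] n \<otimes> x"
    using assms(1,3) y by simp
  then show ?thesis
    using assms(1,3) by (simp add: r_cancel_one')
qed

text \<open>Moving \<open>x\<close> past \<open>y [^] n\<close> kills \<open>c [^] n\<close>, and
  moving \<open>y\<close> past \<open>x [^] m\<close> kills \<open>inv c [^] m\<close>, so the order
  of \<open>c\<close> divides two coprime numbers. Exponents \<open>m\<close>, \<open>n\<close>
  replace the orders because the lemma is applied to cosets, whose orders may be proper
  divisors.\<close>

lemma central_commutator_coprime:
  assumes "x \<in> carrier G" "y \<in> carrier G"
    and c: "c = x \<otimes> y \<otimes> inv x \<otimes> inv y"
    and cx: "c \<otimes> x = x \<otimes> c" and cy: "c \<otimes> y = y \<otimes> c"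
    and "x [^] (m :: nat) = \<one>" "y [^] (n :: nat) = \<one>" "coprime m n"
  shows "c = \<one>"
proof -
  have cG: "c \<in> carrier G"
    using assms(1,2) by (simp add: c)
  have xy: "x \<otimes> y = c \<otimes> y \<otimes> x"
    using assms(1,2) by (simp add: c m_assoc inv_mult_cancel)
  \<comment> \<open>Exchanging the roles of \<open>x\<close> and \<open>y\<close> replaces the
    commutator by its inverse.\<close>
  then have yx: "y \<otimes> x = inv c \<otimes> x \<otimes> y"
    using assms(1,2) cG by (simp add: m_assoc inv_mult_cancel)
  have "inv c \<otimes> (c \<otimes> x) \<otimes> inv c = inv c \<otimes> (x \<otimes> c) \<otimes> inv c"
    by (simp only: cx)
  then have cx': "inv c \<otimes> x = x \<otimes> inv c"
    using assms(1) cG by (simp add: m_assoc inv_mult_cancel)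
  have "inv c [^] m = \<one>"
    by (rule central_commutator_pow_eq_one[OF assms(2,1) inv_closed[OF cG] yx cx' assms(6)])
  moreover have "c [^] n = \<one>"
    by (rule central_commutator_pow_eq_one[OF assms(1,2) cG xy cy assms(7)])
  ultimately have "ord c dvd m" "ord c dvd n"
    using cG pow_eq_id[of c n] pow_eq_id[of "inv c" m] by auto
  then have "ord c = 1"
    using assms(8) coprime_common_divisor_nat by blast
  then show ?thesis
    using cG ord_eq_1 by simp
qed

text \<open>Conjugation maps a commutator to the commutator of the conjugates, so normality passes
  to the next term. It makes the quotients by these terms available.\<close>

lemma lower_central_series_normal: "lower_central_series G n \<lhd> G"
proof (induction n)
  case 0
  show ?case
    by (simp add: normal_inv_iff subgroup_self)
next
  case (Suc n)
  let ?N = "lower_central_series G n"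
  have N: "x \<in> carrier G" if "x \<in> ?N" for x
    using subgroup.mem_carrier[OF normal_imp_subgroup[OF Suc] that] .
  have conj: "g \<otimes> (x \<otimes> y \<otimes> inv x \<otimes> inv y) \<otimes> inv g =
      (g \<otimes> x \<otimes> inv g) \<otimes> (g \<otimes> y \<otimes> inv g) \<otimes> inv (g \<otimes> x \<otimes> inv g) \<otimes> inv (g \<otimes> y \<otimes> inv g)"
    if "g \<in> carrier G" "x \<in> carrier G" "y \<in> carrier G" for g x y
    using that by (simp add: inv_mult_group m_assoc inv_mult_cancel)
  have "\<exists>x'\<in>?N. \<exists>y'\<in>carrier G. g \<otimes> (x \<otimes> y \<otimes> inv x \<otimes> inv y) \<otimes> inv g =
      x' \<otimes> y' \<otimes> inv x' \<otimes> inv y'"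
    if "g \<in> carrier G" "x \<in> ?N" "y \<in> carrier G" for g x y
    using that N conj[of g x y] normal.inv_op_closed2[OF Suc, of g x]
    by (intro bexI[of _ "g \<otimes> x \<otimes> inv g"] bexI[of _ "g \<otimes> y \<otimes> inv g"]) auto
  then show ?case
    using N by (auto intro!: normal_generateI)
qed

lemma lower_central_series_commutator:
  assumes "x \<in> lower_central_series G n" "y \<in> carrier G"
  shows "x \<otimes> y \<otimes> inv x \<otimes> inv y \<in> lower_central_series G (Suc n)"
  using assms by (auto intro!: generate.incl)

text \<open>The commutator \<open>c\<close> descends through the whole lower central series: if it
  lies in term \<open>n\<close>, its image modulo term \<open>n + 1\<close> is central, hence
  trivial by \<open>central_commutator_coprime\<close>. Nilpotency then forces \<open>c\<close> to
  be the identity.\<close>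

lemma nilpotent_coprime_commute:
  assumes nil: "nilpotent_group G" and G: "x \<in> carrier G" "y \<in> carrier G"
    and cop: "coprime (ord x) (ord y)"
  shows "x \<otimes> y = y \<otimes> x"
proof -
  define c where "c = x \<otimes> y \<otimes> inv x \<otimes> inv y"
  have cG: "c \<in> carrier G"
    using G by (simp add: c_def)
  have "c \<in> lower_central_series G n" for n
  proof (induction n)
    case (Suc n)
    define N where "N = lower_central_series G (Suc n)"
    interpret N: normal N G
      unfolding N_def by (rule lower_central_series_normal)
    interpret Q: group "G Mod N"
      by (rule N.factorgroup_is_group)
    interpret \<phi>: group_hom G "G Mod N" "(#>) N"
      by unfold_locales (rule N.r_coset_hom_Mod)
    \<comment> \<open>The commutator of \<open>c\<close> with any \<open>g\<close> falls into the
      next term \<open>N\<close>, so the cosets of \<open>c\<close> and \<open>g\<close>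
      commute.\<close>
    have central: "(N #> c) \<otimes>\<^bsub>G Mod N\<^esub> (N #> g) = (N #> g) \<otimes>\<^bsub>G Mod N\<^esub> (N #> c)"
      if g: "g \<in> carrier G" for g
    proof -
      have "c \<otimes> g \<otimes> inv c \<otimes> inv g \<in> N"
        unfolding N_def using lower_central_series_commutator[OF Suc g] .
      then have "c \<otimes> g \<in> N #> (g \<otimes> c)"
        using g cG unfolding r_coset_def
        by (auto intro!: bexI[of _ "c \<otimes> g \<otimes> inv c \<otimes> inv g"] simp: m_assoc inv_mult_cancel)
      then have "N #> (g \<otimes> c) = N #> (c \<otimes> g)"
        by (rule repr_independence[OF _ m_closed[OF g cG] N.subgroup_axioms])
      then show ?thesis
        by (simp only: \<phi>.hom_mult[OF cG g, symmetric] \<phi>.hom_mult[OF g cG, symmetric])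
    qed
    have "N #> c = \<one>\<^bsub>G Mod N\<^esub>"
    proof (rule Q.central_commutator_coprime)
      show "N #> c = (N #> x) \<otimes>\<^bsub>G Mod N\<^esub> (N #> y) \<otimes>\<^bsub>G Mod N\<^esub> inv\<^bsub>G Mod N\<^esub> (N #> x)
          \<otimes>\<^bsub>G Mod N\<^esub> inv\<^bsub>G Mod N\<^esub> (N #> y)"
        using G by (simp only: c_def \<phi>.hom_mult \<phi>.hom_inv m_closed inv_closed)
      show "(N #> x) [^]\<^bsub>G Mod N\<^esub> ord x = \<one>\<^bsub>G Mod N\<^esub>"
        "(N #> y) [^]\<^bsub>G Mod N\<^esub> ord y = \<one>\<^bsub>G Mod N\<^esub>"
        using G \<phi>.hom_nat_pow \<phi>.hom_one by (metis pow_ord_eq_1)+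
    qed (use central G cop \<phi>.hom_closed in auto)
    then have "N #> c = N"
      by simp
    then show ?case
      using rcos_self[OF cG N.subgroup_axioms] by (simp add: N_def)
  qed (use cG in simp)
  then have "c = \<one>"
    using nil by (auto simp: nilpotent_group_def)
  moreover have "x \<otimes> y = c \<otimes> (y \<otimes> x)"
    using G by (simp add: c_def m_assoc inv_mult_cancel)
  ultimately show ?thesis
    using G by simp
qed

text \<open>Raising \<open>x \<otimes> y\<close> to the power \<open>ord y\<close> removes
  \<open>y\<close> and leaves a generator of the cyclic group of \<open>x\<close>.\<close>

lemma mem_generate_mult_if_coprime:
  assumes "x \<in> carrier G" "y \<in> carrier G" "x \<otimes> y = y \<otimes> x" "coprime (ord x) (ord y)"
  shows "x \<in> generate G {x \<otimes> y}"
proof -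
  have "(x \<otimes> y) [^] ord y = x [^] ord y"
    using assms by (simp add: pow_mult_distrib)
  then have "generate G {x [^] ord y} \<subseteq> generate G {x \<otimes> y}"
    using assms pow_mem_generate[of "x \<otimes> y" "ord y"] by (intro generate_mono_mem) auto
  then show ?thesis
    using mem_generate_pow_if_coprime assms by blast
qed

end

section \<open>Eulerian pair graphs\<close>

text \<open>Connectedness is defined through \<open>mk_symmetric\<close>; this transfers it between
  an undirected graph and an orientation of it.\<close>

lemma mk_symmetric_cong:
  assumes "pverts H = pverts K" "parcs H \<union> (parcs H)\<inverse> = parcs K \<union> (parcs K)\<inverse>"
  shows "mk_symmetric (with_proj H) = mk_symmetric (with_proj K)"
proof -
  have "(\<Union>e\<in>R. {(fst e, snd e), (snd e, fst e)}) = R \<union> R\<inverse>" for R :: "'a rel"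
    by auto
  then show ?thesis
    using assms by (simp add: mk_symmetric_def)
qed

lemma mk_symmetric_eq_if_sym:
  assumes "sym (parcs H)"
  shows "mk_symmetric (with_proj H) = H"
proof -
  have "(\<Union>e\<in>parcs H. {(fst e, snd e), (snd e, fst e)}) = parcs H"
    using assms by (auto dest: symD)
  then show ?thesis
    by (simp add: mk_symmetric_def)
qed

text \<open>A non-loop step is incident with \<open>v\<close> exactly when it switches between being
  at \<open>v\<close> and being away from it, so the parity of these steps only depends on the two
  ends of the walk.\<close>

lemma even_incidences_pcas:
  assumes "pcas u p w" "\<And>e. e \<in> set p \<Longrightarrow> fst e \<noteq> snd e"
  shows "even (length (filter (\<lambda>e. v \<in> edge_of e) p)) \<longleftrightarrow> (u = v \<longleftrightarrow> w = v)"
  using assms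
proof (induction p arbitrary: u)
  case (Cons e p)
  have "even (length (filter (\<lambda>e. v \<in> edge_of e) p)) \<longleftrightarrow> (snd e = v \<longleftrightarrow> w = v)"
    using Cons.prems by (intro Cons.IH) auto
  moreover have "fst e = u" "fst e \<noteq> snd e"
    using Cons.prems by auto
  ultimately show ?case
    by (auto simp: edge_of_def)
qed auto

text \<open>The closed trail traverses each edge at \<open>v\<close> exactly once, so the degree
  counts its steps incident with \<open>v\<close>.\<close>

lemma eulerian_imp_even_degree:
  assumes "pair_graph H" "eulerian H"
  shows "even (card {w. (v, w) \<in> parcs H})"
proof -
  interpret pair_graph H
    by (rule assms(1))
  have sym: "(b, a) \<in> parcs H" if "(a, b) \<in> parcs H" for a b
    using pair_sym_arcs that by (auto simp: symmetric_def dest: symD)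
  obtain u p where p: "pcas u p u" "set p \<subseteq> parcs H" "distinct (map edge_of p)"
    and edges: "edge_of ` set p = edge_of ` parcs H"
    using assms(2)
    by (auto simp: eulerian_def closed_edge_trail_def pre_digraph.awalk_def cas_with_proj_eq)
  let ?E = "{B \<in> edge_of ` parcs H. v \<in> B}"
  have "bij_betw (\<lambda>w. {v, w}) {w. (v, w) \<in> parcs H} ?E"
  proof (rule bij_betwI')
    show "\<exists>w\<in>{w. (v, w) \<in> parcs H}. B = {v, w}" if B: "B \<in> ?E" for B
    proof -
      obtain a b where "B = {a, b}" "(a, b) \<in> parcs H" "v = a \<or> v = b"
        using B by (auto simp: edge_of_def)
      then show ?thesis
        using sym[of a b] by auto
    qed
  qed (auto simp: doubleton_eq_iff edge_of_def image_iff intro!: bexI)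
  then have "card {w. (v, w) \<in> parcs H} = card ?E"
    by (rule bij_betw_same_card)
  also have "?E = set (filter (\<lambda>B. v \<in> B) (map edge_of p))"
    using edges by auto
  also have "card \<dots> = length (filter (\<lambda>B. v \<in> B) (map edge_of p))"
    using p(3) by (intro distinct_card distinct_filter)
  also have "\<dots> = length (filter (\<lambda>e. v \<in> edge_of e) p)"
    by (simp add: filter_map comp_def)
  finally show ?thesis
    using even_incidences_pcas[OF p(1), of v] p(2) pair_no_loops by auto
qed

text \<open>\<open>R\<close> keeps one arc of each edge. Balance gives a directed Euler circuit of
  \<open>R\<close>, which, read on unordered pairs, uses every edge exactly once.\<close>

lemma eulerian_if_balanced_orientation:
  assumes H: "pair_graph H" and conn: "Digraph_Component.connected (with_proj H)"
    and R: "R \<subseteq> parcs H"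
    and orient: "\<And>a b. (a, b) \<in> parcs H \<Longrightarrow> (a, b) \<in> R \<longleftrightarrow> (b, a) \<notin> R"
    and balanced: "\<And>v. v \<in> pverts H \<Longrightarrow> card {w. (w, v) \<in> R} = card {w. (v, w) \<in> R}"
  shows "eulerian H"
proof -
  interpret pair_graph H
    by (rule H)
  define D where "D = \<lparr>pverts = pverts H, parcs = R\<rparr>"
  have "a \<in> pverts H" "b \<in> pverts H" if "(a, b) \<in> R" for a b
    using subsetD[OF R that] in_arcsD1 in_arcsD2 by simp_all
  moreover have "finite R"
    using R pair_finite_arcs by (rule finite_subset)
  ultimately interpret D: pair_fin_digraph D
    using pair_finite_verts by unfold_locales (auto simp: D_def)
  have sym: "(b, a) \<in> parcs H" if "(a, b) \<in> parcs H" for a b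
    using pair_sym_arcs that by (auto simp: symmetric_def dest: symD)
  have "(a, b) \<in> R \<union> R\<inverse> \<longleftrightarrow> (a, b) \<in> parcs H" for a b
    using R orient[of a b] sym[of b a] by blast
  then have RH: "R \<union> R\<inverse> = parcs H"
    by (intro equalityI subrelI) simp_all
  then have "mk_symmetric (with_proj D) = mk_symmetric (with_proj H)"
    by (intro mk_symmetric_cong) (auto simp: D_def)
  then have "Digraph_Component.connected (with_proj D)"
    using conn by (simp add: connected_def)
  moreover have "in_degree (with_proj D) v = out_degree (with_proj D) v" if "v \<in> pverts D" for v
  proof -
    have "in_arcs (with_proj D) v = (\<lambda>w. (w, v)) ` {w. (w, v) \<in> R}"
      "out_arcs (with_proj D) v = (\<lambda>w. (v, w)) ` {w. (v, w) \<in> R}"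
      by (auto simp: D_def in_arcs_def out_arcs_def)
    then show ?thesis
      using balanced[of v] that
      by (simp add: in_degree_def out_degree_def card_image inj_on_def D_def)
  qed
  ultimately obtain u p where "D.euler_trail u p u"
    using D.closed_euler1 by blast
  then have p: "u \<in> pverts H" "pcas u p u" "distinct p" "set p = R"
    by (auto simp: pre_digraph.euler_trail_def pre_digraph.trail_def pre_digraph.awalk_def
        D_def cas_with_proj_eq)
  \<comment> \<open>\<open>R\<close> never contains both an arc and its reverse, so distinct arcs of
    the circuit lie on distinct edges.\<close>
  have "inj_on edge_of R"
  proof (rule inj_onI)
    fix e f assume ef: "e \<in> R" "f \<in> R" "edge_of e = edge_of f"
    then have "e = f \<or> e = (snd f, fst f)"
      by (cases e; cases f) (auto simp: edge_of_def doubleton_eq_iff)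
    then show "e = f"
      using ef orient[of "fst f" "snd f"] R by auto
  qed
  then have "distinct (map edge_of p)"
    using p by (simp add: distinct_map)
  then have "closed_edge_trail H u p"
    using p R by (simp add: closed_edge_trail_def pre_digraph.awalk_def cas_with_proj_eq)
  moreover have "edge_of ` R = edge_of ` parcs H"
  proof -
    have "edge_of ` R\<inverse> = edge_of ` R"
      by (force simp: edge_of_def)
    then show ?thesis
      by (simp add: RH[symmetric] image_Un)
  qed
  ultimately show ?thesis
    using conn p(4) unfolding eulerian_def by metis
qed

text \<open>
  The edges fall into four-cycles \<open>a \<rightarrow> b \<rightarrow> i a \<rightarrow> i b \<rightarrow> a\<close>; orienting each of them
  cyclically balances every vertex. The orientation is read off from an enumeration of the
  vertices: \<open>r\<close> decides which of the two orbits of \<open>i\<close> comes first, and \<open>s\<close> picks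
  one point in each orbit.
\<close>
lemma eulerian_if_free_involution:
  assumes H: "pair_graph H" and conn: "Digraph_Component.connected (with_proj H)"
    and i: "\<And>v. v \<in> pverts H \<Longrightarrow> i v \<in> pverts H"
      "\<And>v. v \<in> pverts H \<Longrightarrow> i (i v) = v"
      "\<And>v. v \<in> pverts H \<Longrightarrow> i v \<noteq> v"
      "\<And>v. (v, i v) \<notin> parcs H"
    and edge: "\<And>v w. (v, w) \<in> parcs H \<Longrightarrow> (v, i w) \<in> parcs H"
  shows "eulerian H"
proof -
  interpret pair_graph H
    by (rule H)
  have sym: "(b, a) \<in> parcs H" if "(a, b) \<in> parcs H" for a b
    using pair_sym_arcs that by (auto simp: symmetric_def dest: symD)
  obtain f :: "'a \<Rightarrow> nat" where f: "inj_on f (pverts H)"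
    using finite_imp_inj_to_nat_seg[OF pair_finite_verts] by blast
  define r where "r v = min (f v) (f (i v))" for v
  define s where "s v \<longleftrightarrow> f v < f (i v)" for v
  define R where "R = {(a, b) \<in> parcs H. r a < r b \<longleftrightarrow> (s a \<longleftrightarrow> s b)}"
  have f_eq: "f v = f w \<longleftrightarrow> v = w" if "v \<in> pverts H" "w \<in> pverts H" for v w
    using f that by (auto dest: inj_onD)
  have r_i: "r (i v) = r v" and s_i: "s (i v) \<longleftrightarrow> \<not> s v" if "v \<in> pverts H" for v
  proof -
    have "f (i v) \<noteq> f v"
      using f_eq that i by metis
    then show "r (i v) = r v" "s (i v) \<longleftrightarrow> \<not> s v"
      using i that by (auto simp: r_def s_def)
  qed
  \<comment> \<open>Equal values of \<open>r\<close> would put \<open>a\<close> and \<open>b\<close>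
    in the same orbit of \<open>i\<close>, where no edge exists.\<close>
  have r_neq: "r a \<noteq> r b" if ab: "(a, b) \<in> parcs H" for a b
  proof
    assume eq: "r a = r b"
    have V: "a \<in> pverts H" "b \<in> pverts H"
      using ab in_arcsD1 in_arcsD2 by auto
    have "f a = f b \<or> f a = f (i b) \<or> f (i a) = f b \<or> f (i a) = f (i b)"
      using eq by (auto simp: r_def min_def split: if_splits)
    then have "a = b \<or> b = i a"
      using V i f_eq by metis
    then show False
      using ab i(4) pair_no_loops[OF ab] by auto
  qed
  show ?thesis
  proof (rule eulerian_if_balanced_orientation[OF H conn])
    show "R \<subseteq> parcs H"
      by (auto simp: R_def)
    show "(a, b) \<in> R \<longleftrightarrow> (b, a) \<notin> R" if "(a, b) \<in> parcs H" for a b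
      using that sym[OF that] r_neq[OF that] by (auto simp: R_def)
    fix v assume v: "v \<in> pverts H"
    \<comment> \<open>Applying \<open>i\<close> to one end keeps \<open>r\<close> and flips
      \<open>s\<close>, which reverses the orientation; exchanging the ends reverses it again. Thus
      \<open>i\<close> matches the out-neighbours of \<open>v\<close> with its
      in-neighbours.\<close>
    have "(i w, v) \<in> R \<longleftrightarrow> (v, w) \<in> R" if w: "w \<in> pverts H" for w
    proof -
      have "(i w, v) \<in> parcs H \<longleftrightarrow> (v, w) \<in> parcs H"
        using edge[of v w] edge[of v "i w"] sym i(2)[OF w] by metis
      then show ?thesis
        using r_neq[of v w] r_i[OF w] s_i[OF w] by (auto simp: R_def)
    qed
    moreover have "w \<in> pverts H" if "(v, w) \<in> R \<or> (w, v) \<in> R" for w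
      using that by (auto simp: R_def dest: in_arcsD1 in_arcsD2)
    ultimately have "bij_betw i {w. (v, w) \<in> R} {w. (w, v) \<in> R}"
      using i by (intro bij_betw_byWitness[where f' = i]) (auto, metis+)
    then show "card {w. (w, v) \<in> R} = card {w. (v, w) \<in> R}"
      by (simp add: bij_betw_same_card)
  qed
qed

section \<open>The difference graph\<close>

lemma exists_prime_dvd_order_neq:
  fixes p :: nat
  assumes "group G" "finite (carrier G)" "Factorial_Ring.prime p" "\<not> p_group p G"
  obtains q where "Factorial_Ring.prime q" "q dvd order G" "q \<noteq> p"
proof -
  have "order G \<noteq> 0"
    using assms(1,2) group.is_monoid monoid.order_gt_0_iff_finite by (metis less_irrefl)
  then obtain m where m: "order G = p ^ multiplicity p (order G) * m" "\<not> p dvd m"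
    using multiplicity_decompose'[of "order G" p] assms(3) not_prime_unit[of p] by metis
  have "m \<noteq> 1"
  proof
    assume "m = 1"
    then have "order G = p ^ multiplicity p (order G)"
      using m(1) by (metis mult.right_neutral)
    then show False
      using assms(1,4) unfolding p_group_def by metis
  qed
  then obtain q where q: "Factorial_Ring.prime q" "q dvd m"
    using prime_factor_nat by blast
  have "q dvd order G"
    by (subst m(1)) (rule dvd_mult[OF q(2)])
  moreover have "q \<noteq> p"
    using q(2) m(2) by auto
  ultimately show ?thesis
    using that q(1) by metis
qed

context group
begin

text \<open>Distinctness is implied by non-membership, as every element lies in its own cyclic
  subgroup; deleting isolated vertices leaves the arcs alone.\<close>

lemma difference_graph_arc_iff:
  "(a, b) \<in> parcs (difference_graph G) \<longleftrightarrow>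
     a \<in> carrier G \<and> b \<in> carrier G \<and> a \<notin> generate G {b} \<and> b \<notin> generate G {a} \<and>
     (\<exists>c\<in>carrier G. a \<in> generate G {c} \<and> b \<in> generate G {c})"
  using mem_generate_self[of a]
  by (auto simp: difference_graph_def remove_isolated_def edge_difference_def
      enhanced_power_graph_def power_graph_def)

lemma difference_graph_vert_iff:
  "v \<in> pverts (difference_graph G) \<longleftrightarrow> (\<exists>w. (v, w) \<in> parcs (difference_graph G))"
proof -
  have "v \<in> pverts (difference_graph G) \<longleftrightarrow>
      v \<in> carrier G \<and> (\<exists>w. (v, w) \<in> parcs (difference_graph G) \<or> (w, v) \<in> parcs (difference_graph G))"
    by (auto simp: difference_graph_def remove_isolated_def edge_difference_def
        enhanced_power_graph_def)
  then show ?thesis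
    by (auto simp: difference_graph_arc_iff)
qed

text \<open>Both elements lie in the cyclic group of \<open>x \<otimes> y\<close>. Neither is a
  power of the other, since its order would then divide a coprime one.\<close>

lemma difference_graph_arc_if_coprime:
  assumes "nilpotent_group G" "x \<in> carrier G" "y \<in> carrier G" "x \<noteq> \<one>" "y \<noteq> \<one>"
    and cop: "coprime (ord x) (ord y)"
  shows "(x, y) \<in> parcs (difference_graph G)"
proof -
  have not_mem: "a \<notin> generate G {b}"
    if "a \<in> carrier G" "b \<in> carrier G" "a \<noteq> \<one>" "coprime (ord a) (ord b)" for a b
    using that ord_dvd_if_mem_generate[of b a] ord_eq_1[of a]
    by (auto simp: coprime_absorb_left)
  have comm: "x \<otimes> y = y \<otimes> x"
    using assms by (intro nilpotent_coprime_commute)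
  have "coprime (ord y) (ord x)"
    using cop by (simp add: coprime_commute)
  then have "y \<in> generate G {x \<otimes> y}" "x \<in> generate G {x \<otimes> y}"
    using mem_generate_mult_if_coprime[OF assms(2,3) comm cop]
      mem_generate_mult_if_coprime[OF assms(3,2) comm[symmetric]] comm by simp_all
  then show ?thesis
    using assms not_mem[of x y] not_mem[of y x] \<open>coprime (ord y) (ord x)\<close>
    unfolding difference_graph_arc_iff by blast
qed

lemma difference_graph_connected:
  assumes fin: "finite (carrier G)" and nil: "nilpotent_group G"
    and no_p: "\<And>p :: nat. Factorial_Ring.prime p \<Longrightarrow> \<not> p_group p G"
  shows "Digraph_Component.connected (with_proj (difference_graph G))"
proof -
  let ?D = "difference_graph G"
  interpret D: pair_graph ?D
    using fin by (rule pair_graph_difference_graph)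
  have sym: "(b, a) \<in> parcs ?D" if "(a, b) \<in> parcs ?D" for a b
    using D.pair_sym_arcs that by (auto simp: symmetric_def dest: symD)
  define P where "P = {x \<in> carrier G. primepow (ord x)}"
  have P_neq: "x \<in> carrier G" "x \<noteq> \<one>" if "x \<in> P" for x
    using that by (auto simp: P_def)
  \<comment> \<open>Supplies a common neighbour for two elements whose orders are powers of the same
    prime \<open>p\<close>.\<close>
  have other: "\<exists>z\<in>P. \<exists>q k. Factorial_Ring.prime q \<and> q \<noteq> p \<and> ord z = q ^ k"
    if p: "Factorial_Ring.prime p" for p
  proof -
    obtain q where q: "Factorial_Ring.prime q" "q dvd order G" "q \<noteq> p"
      using exists_prime_dvd_order_neq[OF is_group fin p no_p[OF p]] .
    obtain z k where "z \<in> carrier G" "k > 0" "ord z = q ^ k"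
      using exists_primepow_ord[OF fin q(1,2)] .
    then have "z \<in> P"
      using q(1) unfolding P_def primepow_def by blast
    then show ?thesis
      using q \<open>ord z = q ^ k\<close> by blast
  qed
  have arc: "(x, y) \<in> parcs ?D"
    if "x \<in> P" "y \<in> P" "ord x = p ^ k" "ord y = q ^ l"
      "Factorial_Ring.prime p" "Factorial_Ring.prime q" "p \<noteq> q" for x y p k q l
    using difference_graph_arc_if_coprime[OF nil P_neq(1)[OF that(1)] P_neq(1)[OF that(2)]
        P_neq(2)[OF that(1)] P_neq(2)[OF that(2)]] that(3-) primes_coprime[of p q]
    by simp
  have reach_P: "x \<rightarrow>\<^sup>*\<^bsub>with_proj ?D\<^esub> y" if x: "x \<in> P" and y: "y \<in> P" for x y
  proof -
    obtain p k where p: "Factorial_Ring.prime p" "ord x = p ^ k"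
      using x by (auto simp: P_def primepow_def)
    obtain q l where q: "Factorial_Ring.prime q" "ord y = q ^ l"
      using y by (auto simp: P_def primepow_def)
    obtain z r m where z: "z \<in> P" "Factorial_Ring.prime r" "r \<noteq> p" "ord z = r ^ m"
      using other[OF p(1)] by blast
    show ?thesis
    proof (cases "p = q")
      case True
      then have "(x, z) \<in> parcs ?D" "(z, y) \<in> parcs ?D"
        using arc[OF x z(1) p(2) z(4) p(1) z(2)] arc[OF z(1) y z(4) q(2) z(2) q(1)] z(3) by auto
      then have "x \<rightarrow>\<^sup>*\<^bsub>with_proj ?D\<^esub> z" "z \<rightarrow>\<^sup>*\<^bsub>with_proj ?D\<^esub> y"
        by (simp_all add: D.reachable_adjI)
      then show ?thesis
        by (rule D.reachable_trans)
    next
      case False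
      then have "(x, y) \<in> parcs ?D"
        using arc[OF x y p(2) q(2) p(1) q(1)] by simp
      then show ?thesis
        by (simp add: D.reachable_adjI)
    qed
  qed
  have to_P: "\<exists>z\<in>P. v \<rightarrow>\<^sup>*\<^bsub>with_proj ?D\<^esub> z" if v: "v \<in> pverts ?D" for v
  proof -
    obtain w c where G: "v \<in> carrier G" "w \<in> carrier G" "c \<in> carrier G"
      and vw: "v \<notin> generate G {w}" "w \<notin> generate G {v}"
      and c: "v \<in> generate G {c}" "w \<in> generate G {c}"
      using v by (auto simp: difference_graph_vert_iff difference_graph_arc_iff)
    show ?thesis
    proof (cases "v \<in> P")
      case True
      then show ?thesis
        using v by (auto intro!: bexI[of _ v])
    next
      case False
      \<comment> \<open>Since \<open>w\<close> is outside the cyclic subgroup of \<open>v\<close>,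
        so is one of its powers of prime power order.\<close>
      obtain z where z: "z \<in> generate G {w}" "primepow (ord z)" "z \<notin> generate G {v}"
        using mem_subgroup_if_primepow_parts_mem[OF fin generate_is_subgroup[of "{v}"] G(2)] G(1) vw(2)
        by blast
      have zG: "z \<in> carrier G"
        using generate_in_carrier[of "{w}" z] z(1) G(2) by simp
      \<comment> \<open>Otherwise the order of \<open>v\<close> would divide a prime power, and
        \<open>v\<close> would belong to \<open>P\<close>.\<close>
      have "v \<notin> generate G {z}"
      proof
        assume "v \<in> generate G {z}"
        then have "ord v dvd ord z"
          by (rule ord_dvd_if_mem_generate[OF zG])
        moreover obtain p k where p: "Factorial_Ring.prime p" "ord z = p ^ k"
          using z(2) by (auto simp: primepow_def)
        ultimately obtain j where j: "ord v = p ^ j"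
          using divides_primepow_nat[OF p(1)] by metis
        have "v \<noteq> \<one>"
          using vw(1) generate.one by metis
        then have "j > 0"
          using j ord_eq_1[OF G(1)] by (cases j) auto
        then have "primepow (ord v)"
          using j p(1) unfolding primepow_def by blast
        then show False
          using False G(1) by (simp add: P_def)
      qed
      moreover have "z \<in> generate G {c}"
        using generate_mono_mem[OF G(3) c(2)] z(1) by blast
      ultimately have "(v, z) \<in> parcs ?D"
        using G z(3) zG c(1) unfolding difference_graph_arc_iff by blast
      then have "v \<rightarrow>\<^sup>*\<^bsub>with_proj ?D\<^esub> z"
        by (simp add: D.reachable_adjI)
      then show ?thesis
        using zG z(2) by (auto simp: P_def)
    qed
  qed
  have "strongly_connected (with_proj ?D)"
  proof (rule strongly_connectedI)
    \<comment> \<open>The prime 2 merely starts the search: it yields an element for some prime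
      \<open>q\<close>, and a second call gives a neighbour for a prime other than
      \<open>q\<close>.\<close>
    obtain z q k where "z \<in> P" "Factorial_Ring.prime q" "ord z = q ^ k"
      using other[OF two_is_prime_nat] by blast
    moreover from this obtain y r l where "y \<in> P" "Factorial_Ring.prime r" "r \<noteq> q" "ord y = r ^ l"
      using other by blast
    ultimately have "(z, y) \<in> parcs ?D"
      using arc by metis
    then show "verts (with_proj ?D) \<noteq> {}"
      using D.in_arcsD1 by auto
    show "u \<rightarrow>\<^sup>*\<^bsub>with_proj ?D\<^esub> v" if uv: "u \<in> verts (with_proj ?D)" "v \<in> verts (with_proj ?D)" for u v
    proof -
      obtain x y where x: "x \<in> P" "u \<rightarrow>\<^sup>*\<^bsub>with_proj ?D\<^esub> x"
        and y: "y \<in> P" "v \<rightarrow>\<^sup>*\<^bsub>with_proj ?D\<^esub> y"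
        using uv to_P[of u] to_P[of v] by auto
      have "y \<rightarrow>\<^sup>*\<^bsub>with_proj ?D\<^esub> v"
        using D.sym_arcs y(2) by (rule symmetric_reachable)
      then show ?thesis
        using x(2) reach_P[OF x(1) y(1)] D.reachable_trans by blast
    qed
  qed
  moreover have "mk_symmetric (with_proj ?D) = ?D"
    using sym by (intro mk_symmetric_eq_if_sym symI)
  ultimately show ?thesis
    by (simp add: connected_def)
qed

section \<open>Inversion and the parity of degrees\<close>

text \<open>An element and its inverse generate the same subgroup and lie in the same cyclic
  subgroups, so adjacency cannot tell them apart.\<close>

lemma difference_graph_arc_inv:
  assumes "(v, w) \<in> parcs (difference_graph G)"
  shows "(v, inv w) \<in> parcs (difference_graph G)"
  using assms by (auto simp: difference_graph_arc_iff generate_inv inv_mem_generate_iff)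

lemma inv_eq_self_imp_ord_dvd_2:
  assumes "x \<in> carrier G" "inv x = x"
  shows "ord x dvd 2"
proof -
  have "x [^] (2 :: nat) = \<one>"
    using assms(1) r_inv[OF assms(1)] by (simp add: numeral_2_eq_2 assms(2))
  then show ?thesis
    using assms(1) by (simp add: pow_eq_id)
qed

lemma inv_eq_self_imp_one_if_odd:
  assumes "odd (order G)" "x \<in> carrier G" "inv x = x"
  shows "x = \<one>"
proof -
  have "ord x dvd 2"
    using assms(2,3) by (rule inv_eq_self_imp_ord_dvd_2)
  moreover have "odd (ord x)"
    using ord_dvd_group_order[OF assms(2)] assms(1) by (metis dvd_trans)
  ultimately have "ord x = 1"
    using two_is_prime_nat prime_nat_iff by (metis dvd_refl)
  then show ?thesis
    using assms(2) ord_eq_1 by simp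
qed

text \<open>Inversion serves as the free involution: the identity is not a vertex, odd order leaves
  no other self-inverse element, and \<open>v\<close>, \<open>inv v\<close> are never adjacent
  because each is a power of the other.\<close>

lemma eulerian_difference_graph_if_odd:
  assumes fin: "finite (carrier G)" and nil: "nilpotent_group G"
    and no_p: "\<And>p :: nat. Factorial_Ring.prime p \<Longrightarrow> \<not> p_group p G"
    and odd: "odd (order G)"
  shows "eulerian (difference_graph G)"
proof (rule eulerian_if_free_involution)
  let ?D = "difference_graph G"
  have V: "v \<in> carrier G" "v \<noteq> \<one>" if "v \<in> pverts ?D" for v
    using that generate.one by (auto simp: difference_graph_vert_iff difference_graph_arc_iff)
  show "pair_graph ?D"
    using fin by (rule pair_graph_difference_graph)
  have sym: "(b, a) \<in> parcs ?D" if "(a, b) \<in> parcs ?D" for a b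
    using that by (auto simp: difference_graph_arc_iff)
  show "Digraph_Component.connected (with_proj ?D)"
    using fin nil no_p by (rule difference_graph_connected)
  show "inv v \<in> pverts ?D" if "v \<in> pverts ?D" for v
    using that sym difference_graph_arc_inv unfolding difference_graph_vert_iff by blast
  show "inv (inv v) = v" if "v \<in> pverts ?D" for v
    using V[OF that] by simp
  show "inv v \<noteq> v" if "v \<in> pverts ?D" for v
    using inv_eq_self_imp_one_if_odd[OF odd] V[OF that] by blast
  show "(v, inv v) \<notin> parcs ?D" for v
    by (auto simp: difference_graph_arc_iff intro: generate.inv)
qed (rule difference_graph_arc_inv)

lemma not_eulerian_difference_graph_if_even:
  assumes fin: "finite (carrier G)" and nil: "nilpotent_group G"
    and no_p: "\<And>p :: nat. Factorial_Ring.prime p \<Longrightarrow> \<not> p_group p G"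
    and even: "even (order G)"
  shows "\<not> eulerian (difference_graph G)"
proof -
  let ?D = "difference_graph G"
  obtain q where q: "Factorial_Ring.prime q" "q dvd order G" "q \<noteq> 2"
    using exists_prime_dvd_order_neq[OF is_group fin two_is_prime_nat no_p[OF two_is_prime_nat]] .
  obtain x k where x: "x \<in> carrier G" "k > 0" "ord x = q ^ k"
    using exists_primepow_ord[OF fin q(1,2)] .
  have "odd q"
    using q(1,3) primes_dvd_imp_eq two_is_prime_nat by metis
  then have cop: "coprime (ord x) 2"
    using x(3) by simp
  have "x \<noteq> \<one>"
    using x one_less_power[OF prime_gt_1_nat[OF q(1)] x(2)] by auto
  let ?N = "{w. (x, w) \<in> parcs ?D}"
  let ?I = "{w \<in> carrier G. inv w = w}"
  have N: "w \<in> carrier G" "w \<noteq> \<one>" if "w \<in> ?N" for w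
    using that generate.one by (auto simp: difference_graph_arc_iff)
  have I: "w \<in> ?N" if w: "w \<in> ?I" "w \<noteq> \<one>" for w
  proof -
    have "ord w dvd 2"
      using w(1) by (intro inv_eq_self_imp_ord_dvd_2) simp_all
    then have "coprime (ord x) (ord w)"
      using cop coprime_divisors[of "ord x" "ord x" "ord w" 2] by simp
    then show ?thesis
      using difference_graph_arc_if_coprime[OF nil x(1) _ \<open>x \<noteq> \<one>\<close> w(2)] w(1) by simp
  qed
  have "finite ?I"
    using fin by simp
  \<comment> \<open>The identity is adjacent to nothing, while every involution has order coprime to
    that of \<open>x\<close> and hence is a neighbour.\<close>
  have "{w \<in> ?N. inv w = w} = ?I - {\<one>}"
    using N I by auto
  moreover have "even (card ?N) \<longleftrightarrow> even (card {w \<in> ?N. inv w = w})"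
  proof (rule even_card_involution_iff)
    show "finite ?N"
      using fin by (rule finite_subset[rotated]) (use N in blast)
  qed (use N difference_graph_arc_inv in auto)
  \<comment> \<open>The same pairing on the whole group: \<open>?I\<close> has the parity of the
    group order, and discarding the identity makes the count odd.\<close>
  moreover have "even (card ?I)"
    using even_card_involution_iff[of "carrier G" "m_inv G"] fin even by (simp add: order_def)
  moreover have "even (card ?I) \<longleftrightarrow> odd (card (?I - {\<one>}))"
    using card.remove[OF \<open>finite ?I\<close>, of "\<one>"] by (metis (mono_tags, lifting)
        even_Suc inv_one mem_Collect_eq one_closed)
  ultimately have "odd (card ?N)"
    by metis
  then show ?thesis
    using eulerian_imp_even_degree[OF pair_graph_difference_graph[OF fin], of x] by blast
qed

end

theorem theorem4p7:
  fixes G :: "('a, 'b) monoid_scheme"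
  assumes "group G"
    and "finite (carrier G)"
    and "nilpotent_group G"
    and "\<And>p :: nat. Factorial_Ring.prime p \<Longrightarrow> \<not> p_group p G"
  shows "eulerian (difference_graph G) \<longleftrightarrow> odd (order G)"
  using group.eulerian_difference_graph_if_odd[OF assms]
    group.not_eulerian_difference_graph_if_even[OF assms] by blast

end
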